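(* Let $G$ be a finitely generated semigroup with finite generating set $G_1$, and let $G\times X\to X$ be a continuous action on a compact metric space $X$ that satisfies the weak orbital specification property with sets of admissible elements $\tilde G_p\subset G_p^*$ satisfying $$\limsup_{p\to\infty}\frac{|G_p^*\setminus\tilde G_p|}{m^{\gamma p}}<1\qquad\text{for every }0<\gamma<1 .$$ Then the semigroup action has positive topological entropy, i.e. $h_{top}((G,G_1),X)>0$.
   Context: Setting: $G$ is a semigroup with identity $id$ and finite generating set $G_1$ containing $id$; $G_1^*=G_1\setminus\{id\}$ and $m=|G_1^*|$. A continuous action on $X$ assigns to every $g\in G$ a continuous map $g:X\to X$, with $id$ acting as the identity and products acting as compositions. $G_n^*$ is the set of elements $g_{i_n}\cdots g_{i_1}$ with all $g_{i_j}\in G_1^*$. Weak orbital specification property: for every $\varepsilon>0$ there is $p(\varepsilon)>0$ such that for every $p\ge p(\varepsilon)$ there is a set $\tilde G_p\subset G_p^*$ (possibly depending on $\varepsilon$) with $\lim_{p\to\infty}\sharp\tilde G_p/\sharp G_p^*=1$ and the following holds: for any $k\ge1$, any $\underline h_{p_j}\in\tilde G_{p_j}$ with $p_j\ge p(\varepsilon)$, any points $x_1,\dots,x_k\in X$, any natural numbers $n_1,\dots,n_k$ and any concatenations $\underline g_{n_j,j}=g_{i_{n_j},j}\cdots g_{i_2,j}g_{i_1,j}$ of $n_j$ elements of $G_1$ ($1\le j\le k$), there is $x\in X$ such that $d(\underline g_{\ell,1}(x),\underline g_{\ell,1}(x_1))<\varepsilon$ for $\ell=1,\dots,n_1$ and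 $d(\underline g_{\ell,j}\,\underline h_{p_{j-1}}\cdots\underline g_{n_2,2}\,\underline h_{p_1}\,\underline g_{n_1,1}(x),\underline g_{\ell,j}(x_j))<\varepsilon$ for $j=2,\dots,k$ and $\ell=1,\dots,n_j$, where $\underline g_{\ell,j}:=g_{i_\ell,j}\cdots g_{i_1,j}$. The growth hypothesis in the claim is imposed on the sets $\tilde G_p$ of this definition, for each $\varepsilon>0$. Topological entropy: for a concatenation $\underline g=g_{i_n}\cdots g_{i_1}$ of generators put $\underline g_0=id$, $\underline g_j=g_{i_j}\cdots g_{i_1}$ and $d_{\underline g}(x,y)=\max_{0\le j\le n}d(\underline g_j(x),\underline g_j(y))$ (this depends on the concatenation). Let $s(\underline g,n,\varepsilon)$ be the maximal cardinality of a set $K\subset X$ with $d_{\underline g}(x_1,x_2)>\varepsilon$ for all distinct $x_1,x_2\in K$. Then $h_{top}((G,G_1),X)=\lim_{\varepsilon\to0}\limsup_{n\to\infty}\frac1n\log\Big(\frac1{m^n}\sum_{\underline g}s(\underline g,n,\varepsilon)\Big)$, the sum being over all $m^n$ concatenations $\underline g$ of $n$ elements of $G_1^*$.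
   Formalization: The formal theorem additionally assumes that X has at least two points; for a one-point X all the hypotheses can hold (e.g. free semigroup on two generators, all elements admissible) while the topological entropy is 0. *)

theory Defs
  imports "HOL-Analysis.Analysis"
begin

(* A concatenation g_{i_n} ... g_{i_1} is represented by the list [g_{i_1}, ..., g_{i_n}],
   i.e. in the order in which the generators are applied; initial segments of the
   concatenation are therefore given by take. *)

definition cprod :: "'g::monoid_mult list \<Rightarrow> 'g" where
  "cprod w = prod_list (rev w)"

definition gen_set :: "'g::monoid_mult set \<Rightarrow> bool" where
  "gen_set G1 \<longleftrightarrow> finite G1 \<and> 1 \<in> G1 \<and> (\<forall>g. \<exists>w. set w \<subseteq> G1 \<and> g = cprod w)"

definition words :: "'g set \<Rightarrow> nat \<Rightarrow> 'g list set" where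
  "words A n = {w. set w \<subseteq> A \<and> length w = n}"

(* G_n^*, a set of elements of the semigroup: different words may give the same element. *)
definition G_star :: "'g::monoid_mult set \<Rightarrow> nat \<Rightarrow> 'g set" where
  "G_star G1 n = cprod ` words (G1 - {1}) n"

definition continuous_action :: "('g::monoid_mult \<Rightarrow> 'x::topological_space \<Rightarrow> 'x) \<Rightarrow> bool" where
  "continuous_action act \<longleftrightarrow>
     (\<forall>g. continuous_on UNIV (act g)) \<and> act 1 = id \<and> (\<forall>g h. act (g * h) = act g \<circ> act h)"

(* The block w j is the concatenation g_{n_j,j} and h j is the element separating the blocks j
   and j + 1; indices start at 1. The value at j is
   h_{j-1} g_{n_{j-1},j-1} ... h_1 g_{n_1,1}, which is the identity for j = 1. *)
definition spec_prefix :: "(nat \<Rightarrow> 'g::monoid_mult list) \<Rightarrow> (nat \<Rightarrow> 'g) \<Rightarrow> nat \<Rightarrow> 'g" where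
  "spec_prefix w h j = cprod (map (\<lambda>i. h i * cprod (w i)) [1..<j])"

definition shadowing ::
  "('g::monoid_mult \<Rightarrow> 'x::metric_space \<Rightarrow> 'x) \<Rightarrow> real \<Rightarrow> nat \<Rightarrow>
   (nat \<Rightarrow> 'g list) \<Rightarrow> (nat \<Rightarrow> 'g) \<Rightarrow> (nat \<Rightarrow> 'x) \<Rightarrow> 'x \<Rightarrow> bool" where
  "shadowing act \<epsilon> k w h xs x \<longleftrightarrow>
     (\<forall>j\<in>{1..k}. \<forall>l\<in>{1..length (w j)}.
        dist (act (cprod (take l (w j)) * spec_prefix w h j) x)
             (act (cprod (take l (w j))) (xs j)) < \<epsilon>)"

(* P \<epsilon> is the threshold p(\<epsilon>) and Gt \<epsilon> p the set of admissible elements of G_p^*;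
   the weak orbital specification property is the existence of such P and Gt. *)
definition weak_orbital_specification ::
  "'g::monoid_mult set \<Rightarrow> ('g \<Rightarrow> 'x::metric_space \<Rightarrow> 'x) \<Rightarrow>
   (real \<Rightarrow> nat) \<Rightarrow> (real \<Rightarrow> nat \<Rightarrow> 'g set) \<Rightarrow> bool" where
  "weak_orbital_specification G1 act P Gt \<longleftrightarrow>
     (\<forall>\<epsilon>>0.
        P \<epsilon> > 0 \<and>
        (\<forall>p\<ge>P \<epsilon>. Gt \<epsilon> p \<subseteq> G_star G1 p) \<and>
        ((\<lambda>p. real (card (Gt \<epsilon> p)) / real (card (G_star G1 p))) \<longlonglongrightarrow> 1) \<and>
        (\<forall>(k::nat) (p :: nat \<Rightarrow> nat) h w xs.
           k \<ge> 1 \<longrightarrow>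
           (\<forall>j\<in>{1..<k}. p j \<ge> P \<epsilon> \<and> h j \<in> Gt \<epsilon> (p j)) \<longrightarrow>
           (\<forall>j\<in>{1..k}. w j \<noteq> [] \<and> set (w j) \<subseteq> G1) \<longrightarrow>
           (\<exists>x. shadowing act \<epsilon> k w h xs x)))"

definition dyn_dist ::
  "('g::monoid_mult \<Rightarrow> 'x::metric_space \<Rightarrow> 'x) \<Rightarrow> 'g list \<Rightarrow> 'x \<Rightarrow> 'x \<Rightarrow> real" where
  "dyn_dist act w x y =
     Max ((\<lambda>j. dist (act (cprod (take j w)) x) (act (cprod (take j w)) y)) ` {0..length w})"

(* The set of cardinalities is bounded, so that Max is attained, for a continuous action on a
   compact space and \<epsilon> > 0. *)
definition sep_number ::
  "('g::monoid_mult \<Rightarrow> 'x::metric_space \<Rightarrow> 'x) \<Rightarrow> 'g list \<Rightarrow> real \<Rightarrow> nat" where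
  "sep_number act w \<epsilon> =
     Max {card K | K. finite K \<and> (\<forall>x\<in>K. \<forall>y\<in>K. x \<noteq> y \<longrightarrow> dyn_dist act w x y > \<epsilon>)}"

(* ereal-valued, since the entropy may be infinite. The quantity under Lim is nonincreasing in
   \<epsilon> on (0, \<infinity>), so the limit exists. *)
definition top_entropy ::
  "'g::monoid_mult set \<Rightarrow> ('g \<Rightarrow> 'x::metric_space \<Rightarrow> 'x) \<Rightarrow> ereal" where
  "top_entropy G1 act =
     Lim (at_right (0::real)) (\<lambda>\<epsilon>. limsup (\<lambda>n. ereal (1 / real n *
       ln (1 / real (card (G1 - {1})) ^ n *
           (\<Sum>w\<in>words (G1 - {1}) n. real (sep_number act w \<epsilon>))))))"

end

theory Submission
  imports Defs
begin

text \<open>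
  Fix a small scale \<open>\<epsilon>\<close> and a length \<open>p\<close> for which some element of length \<open>p\<close> is
  admissible, and cut every word of length \<open>k p\<close> into \<open>k\<close> blocks of length \<open>p\<close>. An admissible
  block serves as a transition element of the specification property; the other blocks are
  absorbed, behind a leading identity, into the concatenations to be shadowed. The leading
  identity lets the shadowing orbit be near either of two fixed points just before each run, so a
  word with \<open>c\<close> admissible blocks has at least \<open>2^c\<close> separated points. If \<open>\<theta> > 0\<close> is the
  proportion of admissible words of length \<open>p\<close>, the average of \<open>2^c\<close> over all words of length
  \<open>k p\<close> is \<open>(1 + \<theta>)^k\<close>, hence the entropy is at least \<open>ln (1 + \<theta>) / p\<close>.
\<close>

section \<open>Words, their products and their decomposition into blocks\<close>

lemma cprod_Nil [simp]: "cprod [] = 1"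
  by (simp add: cprod_def)

lemma cprod_Cons [simp]: "cprod (x # xs) = cprod xs * x"
  by (simp add: cprod_def)

lemma cprod_append [simp]: "cprod (xs @ ys) = cprod ys * cprod xs"
  by (simp add: cprod_def)

lemma words_0 [simp]: "words A 0 = {[]}"
  by (auto simp: words_def)

lemma words_Suc: "words A (Suc n) = (\<lambda>(x, xs). x # xs) ` (A \<times> words A n)"
  by (auto simp: words_def length_Suc_conv image_iff)

lemma finite_words [simp]: "finite A \<Longrightarrow> finite (words A n)"
  by (induction n) (auto simp: words_Suc)

text \<open>Distributivity expands the power. The constant \<open>f = 1\<close> counts words; over
  the alphabet of blocks, weights 2 and 1 evaluate the sum of powers of 2 behind the entropy
  bound.\<close>

lemma sum_words_prod_list:
  fixes f :: "'a \<Rightarrow> 'b::comm_semiring_1"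
  shows "(\<Sum>xs\<in>words A n. prod_list (map f xs)) = (\<Sum>x\<in>A. f x) ^ n"
proof (induction n)
  case (Suc n)
  have "inj_on (\<lambda>(x, xs). x # xs) (A \<times> words A n)"
    by (auto simp: inj_on_def)
  then have "(\<Sum>xs\<in>words A (Suc n). prod_list (map f xs))
      = (\<Sum>(x, xs)\<in>A \<times> words A n. f x * prod_list (map f xs))"
    by (simp add: words_Suc sum.reindex case_prod_unfold)
  also have "\<dots> = (\<Sum>x\<in>A. f x) * (\<Sum>xs\<in>words A n. prod_list (map f xs))"
    by (simp add: sum.cartesian_product[symmetric] sum_product)
  finally show ?case
    by (simp add: Suc.IH)
qed simp

lemma card_words: "card (words A n) = card A ^ n"
  using sum_words_prod_list[of "\<lambda>_. 1::nat" A n]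
  by (simp add: map_replicate_const)

text \<open>All blocks have the same length, so a word can be cut into them in only one way.\<close>

lemma inj_on_concat_words: "inj_on concat (words (words A p) k)"
proof (rule inj_onI)
  fix vs vs' assume *: "vs \<in> words (words A p) k" "vs' \<in> words (words A p) k"
    and eq: "concat vs = concat vs'"
  have "\<forall>(x, y)\<in>set (zip vs vs'). length x = length y"
    using * by (fastforce simp: words_def dest: set_zip_leftD set_zip_rightD)
  then show "vs = vs'"
    using concat_injective[OF eq] * by (auto simp: words_def)
qed

lemma concat_words: "concat ` words (words A p) k \<subseteq> words A (k * p)"
proof -
  have "length (concat vs) = length vs * p" if "\<forall>v\<in>set vs. length v = p" for vs :: "'a list list"
    using that by (induction vs) auto
  then show ?thesis
    by (fastforce simp: words_def)
qed

section \<open>Separated sets and separation numbers\<close>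

definition separated ::
  "('g::monoid_mult \<Rightarrow> 'x::metric_space \<Rightarrow> 'x) \<Rightarrow> 'g list \<Rightarrow> real \<Rightarrow> 'x set \<Rightarrow> bool" where
  "separated act w \<epsilon> K \<longleftrightarrow>
     finite K \<and> (\<forall>x\<in>K. \<forall>y\<in>K. x \<noteq> y \<longrightarrow> dyn_dist act w x y > \<epsilon>)"

lemma sep_number_eq: "sep_number act w \<epsilon> = Max {card K | K. separated act w \<epsilon> K}"
  by (simp add: sep_number_def separated_def)

lemma dyn_dist_gt_iff:
  "dyn_dist act w x y > \<epsilon> \<longleftrightarrow>
     (\<exists>j\<le>length w. dist (act (cprod (take j w)) x) (act (cprod (take j w)) y) > \<epsilon>)"
  unfolding dyn_dist_def by (subst Max_gr_iff) auto

text \<open>By compactness, finitely many open \<open>dyn_dist\<close> balls of radius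
  \<open>\<epsilon> / 2\<close> cover the space. Distinct points of a separated set lie in different
  balls, so the number of balls bounds every cardinality.\<close>

lemma finite_card_separated:
  fixes act :: "'g::monoid_mult \<Rightarrow> 'x::metric_space \<Rightarrow> 'x"
  assumes "compact (UNIV :: 'x set)" "continuous_action act" "\<epsilon> > 0"
  shows "finite {card K | K. separated act w \<epsilon> K}"
proof -
  define U where "U x = (\<Inter>j\<in>{..length w}.
    {y. dist (act (cprod (take j w)) x) (act (cprod (take j w)) y) < \<epsilon> / 2})" for x
  have "open (U x)" for x
    unfolding U_def using assms(2)
    by (intro open_INT open_Collect_less continuous_intros ballI)
       (auto simp: continuous_action_def intro!: continuous_intros)
  moreover have "x \<in> U x" for x
    using assms(3) by (simp add: U_def)
  ultimately obtain C where C: "finite C" "UNIV \<subseteq> (\<Union>x\<in>C. U x)"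
    using compactE_image[OF assms(1), of UNIV U] by (metis UNIV_I UN_I subsetI)
  then have "\<forall>y. \<exists>c\<in>C. y \<in> U c"
    by blast
  then obtain c where c: "\<And>y. c y \<in> C" "\<And>y. y \<in> U (c y)"
    by metis
  have "card K \<le> card C" if K: "separated act w \<epsilon> K" for K
  proof (rule card_inj_on_le)
    show "inj_on c K"
    proof (rule inj_onI, rule ccontr)
      fix x y assume xy: "x \<in> K" "y \<in> K" "c x = c y" "x \<noteq> y"
      then obtain j where j: "j \<le> length w"
        "dist (act (cprod (take j w)) x) (act (cprod (take j w)) y) > \<epsilon>"
        using K by (auto simp: separated_def dyn_dist_gt_iff)
      have "dist (act (cprod (take j w)) (c x)) (act (cprod (take j w)) x) < \<epsilon> / 2"
        "dist (act (cprod (take j w)) (c x)) (act (cprod (take j w)) y) < \<epsilon> / 2"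
        using c(2)[of x] c(2)[of y] j(1) xy(3) by (auto simp: U_def)
      then show False
        using j(2) by metric
    qed
  qed (use c C in auto)
  then show ?thesis
    by (intro finite_subset[OF _ finite_atMost[of "card C"]]) auto
qed

lemma card_le_sep_number:
  fixes act :: "'g::monoid_mult \<Rightarrow> 'x::metric_space \<Rightarrow> 'x"
  assumes "compact (UNIV :: 'x set)" "continuous_action act" "\<epsilon> > 0"
    and "separated act w \<epsilon> K"
  shows "card K \<le> sep_number act w \<epsilon>"
  unfolding sep_number_eq using assms(4) by (intro Max_ge finite_card_separated[OF assms(1-3)]) auto

lemma sep_number_pos:
  fixes act :: "'g::monoid_mult \<Rightarrow> 'x::metric_space \<Rightarrow> 'x"
  assumes "compact (UNIV :: 'x set)" "continuous_action act" "\<epsilon> > 0"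
  shows "sep_number act w \<epsilon> > 0"
  using card_le_sep_number[OF assms, of w "{undefined}"] by (simp add: separated_def)

lemma sep_number_antimono:
  fixes act :: "'g::monoid_mult \<Rightarrow> 'x::metric_space \<Rightarrow> 'x"
  assumes "compact (UNIV :: 'x set)" "continuous_action act" "0 < \<epsilon>" "\<epsilon> \<le> \<epsilon>'"
  shows "sep_number act w \<epsilon>' \<le> sep_number act w \<epsilon>"
proof -
  have "separated act w \<epsilon> K" if "separated act w \<epsilon>' K" for K
    using that assms(4) by (force simp: separated_def)
  \<comment> \<open>Comparing the two maxima requires a nonempty set of cardinalities.\<close>
  moreover have "separated act w \<epsilon>' {}"
    by (simp add: separated_def)
  ultimately show ?thesis
    unfolding sep_number_eq
    by (intro Max_mono finite_card_separated[OF assms(1-3)]) blast+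
qed

section \<open>Separated points from specification\<close>

lemma spec_prefix_blocks:
  assumes "n \<le> length bs"
    and "\<And>i. i < length bs \<Longrightarrow> h (Suc i) * cprod (w (Suc i)) = cprod (f (bs ! i))"
  shows "spec_prefix w h (Suc n) = cprod (concat (map f (take n bs)))"
  using assms(1)
proof (induction n)
  case (Suc n)
  then show ?case
    using assms(2)[of n] by (simp add: spec_prefix_def take_Suc_conv_app_nth)
qed (simp add: spec_prefix_def)

text \<open>For each set \<open>S\<close> of block indices, specification gives a point whose orbit
  is near \<open>a\<close> just before run \<open>j\<close> if \<open>j\<close> is in
  \<open>S\<close>, and near \<open>b\<close> otherwise. Different sets disagree at some index,
  which separates their points. The tail \<open>t\<close> only lengthens the word and is not
  shadowed.\<close>

lemma blocks_sep_number:
  fixes act :: "'g::monoid_mult \<Rightarrow> 'x::metric_space \<Rightarrow> 'x"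
  assumes X: "compact (UNIV :: 'x set)" and act: "continuous_action act"
    and spec: "weak_orbital_specification G1 act P Gt" and one: "1 \<in> G1"
    and \<epsilon>: "\<epsilon> > 0" "3 * \<epsilon> \<le> dist (a :: 'x) b" and p: "p \<ge> P \<epsilon>"
    and bs: "\<And>u v. (u, v) \<in> set bs \<Longrightarrow> set u \<subseteq> G1 \<and> cprod v \<in> Gt \<epsilon> p"
  shows "2 ^ length bs \<le> sep_number act (concat (map (\<lambda>(u, v). u @ v) bs) @ t) \<epsilon>"
proof -
  define f :: "'g list \<times> 'g list \<Rightarrow> 'g list" where "f = (\<lambda>(u, v). u @ v)"
  define c W where "c = length bs" and "W = concat (map f bs) @ t"
  \<comment> \<open>The leading 1 leaves the product unchanged and makes the block nonempty. Since
    \<open>shadowing\<close> only tests \<open>l \<ge> 1\<close>, it also makes the state before the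
    run visible, at \<open>l = 1\<close>. The \<open>c\<close> transition elements join
    \<open>c + 1\<close> blocks, the last being just \<open>[1]\<close>.\<close>
  define w where "w j = 1 # (if j \<le> c then fst (bs ! (j - 1)) else [])" for j
  define h where "h j = cprod (snd (bs ! (j - 1)))" for j
  define xs where "xs S j = (if j \<in> S then a else b)" for S and j :: nat
  have bs': "set (fst (bs ! i)) \<subseteq> G1" "cprod (snd (bs ! i)) \<in> Gt \<epsilon> p" if "i < c" for i
    using bs[of "fst (bs ! i)" "snd (bs ! i)"] that by (auto simp: c_def)
  have "\<exists>x. shadowing act \<epsilon> (Suc c) w h (xs S) x" for S
  proof -
    have "\<forall>j\<in>{1..<Suc c}. p \<ge> P \<epsilon> \<and> h j \<in> Gt \<epsilon> p"
      using bs'(2) p by (auto simp: h_def)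
    moreover have "set (w j) \<subseteq> G1" if "j \<in> {1..Suc c}" for j
      using that one bs'(1)[of "j - 1"] by (cases "j \<le> c") (auto simp: w_def)
    then have "\<forall>j\<in>{1..Suc c}. w j \<noteq> [] \<and> set (w j) \<subseteq> G1"
      by (simp add: w_def)
    ultimately show ?thesis
      using spec[unfolded weak_orbital_specification_def, rule_format, OF \<epsilon>(1), THEN conjunct2,
        THEN conjunct2, THEN conjunct2, rule_format, of "Suc c" "\<lambda>_. p" h w "xs S"] by auto
  qed
  then obtain x where x: "\<And>S. shadowing act \<epsilon> (Suc c) w h (xs S) (x S)"
    by metis
  \<comment> \<open>The orbit just before run \<open>j\<close> is thus visited along
    \<open>W\<close>, at one of the times over which \<open>dyn_dist\<close> takes its
    maximum.\<close>
  have prefix: "\<exists>l\<le>length W. spec_prefix w h j = cprod (take l W)" if "j \<in> {1..c}" for j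
  proof -
    define n where "n = j - 1"
    have n: "j = Suc n" "n \<le> c"
      using that by (auto simp: n_def)
    have "spec_prefix w h j = cprod (concat (map f (take n bs)))"
      unfolding n using n(2)
      by (intro spec_prefix_blocks) (auto simp: h_def w_def f_def c_def case_prod_unfold)
    moreover have "W = concat (map f (take n bs)) @ concat (map f (drop n bs)) @ t"
      unfolding W_def by (simp flip: append_assoc concat_append map_append)
    ultimately show ?thesis
      by (intro exI[of _ "length (concat (map f (take n bs)))"]) simp
  qed
  have near: "dist (act (spec_prefix w h j) (x S)) (xs S j) < \<epsilon>" if "j \<in> {1..c}" for j S
    using x[of S, unfolded shadowing_def, rule_format, of j 1] that act
    by (simp add: w_def continuous_action_def)
  have far: "dyn_dist act W (x S) (x T) > \<epsilon>" if ST: "S \<subseteq> {1..c}" "T \<subseteq> {1..c}" "S \<noteq> T" for S T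
  proof -
    obtain j where j: "j \<in> {1..c}" "j \<in> S \<longleftrightarrow> j \<notin> T"
      using ST by blast
    then have "dist (xs S j) (xs T j) = dist a b"
      by (auto simp: xs_def dist_commute)
    \<comment> \<open>Two errors below \<open>\<epsilon>\<close> leave more than
      \<open>\<epsilon>\<close> of a gap of at least \<open>3 * \<epsilon>\<close>.\<close>
    moreover have "dist u v > \<epsilon>" if "dist u y < \<epsilon>" "dist v z < \<epsilon>" "dist y z = dist a b"
      for u v y z :: 'x
      using that \<epsilon>(2) dist_triangle[of y z u] dist_triangle[of u z v] by (simp add: dist_commute)
    ultimately have "dist (act (spec_prefix w h j) (x S)) (act (spec_prefix w h j) (x T)) > \<epsilon>"
      using near[OF j(1)] by blast
    then show ?thesis
      using prefix[OF j(1)] by (auto simp: dyn_dist_gt_iff)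
  qed
  have "dyn_dist act W y y = 0" for y
    by (simp add: dyn_dist_def)
  then have "inj_on x (Pow {1..c})"
    using far \<epsilon>(1) by (metis (no_types, lifting) PowD inj_onI less_asym)
  then have "card (x ` Pow {1..c}) = 2 ^ c"
    by (simp add: card_image card_Pow)
  moreover have "separated act W \<epsilon> (x ` Pow {1..c})"
    unfolding separated_def using far by auto
  ultimately show ?thesis
    using card_le_sep_number[OF X act \<epsilon>(1)] by (metis W_def c_def f_def)
qed

section \<open>Summing over all words by counting admissible blocks\<close>

lemma split_at_good_blocks:
  assumes "\<And>v. v \<in> set vs \<Longrightarrow> set v \<subseteq> A"
  shows "\<exists>bs t. concat vs = concat (map (\<lambda>(u, v). u @ v) bs) @ t \<and>
    length bs = length (filter Q vs) \<and> (\<forall>(u, v)\<in>set bs. set u \<subseteq> A \<and> Q v)"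
  using assms
proof (induction vs)
  case Nil
  show ?case
    by (intro exI[of _ "[]"]) simp
next
  case (Cons v vs)
  then obtain bs t where bs: "concat vs = concat (map (\<lambda>(u, v). u @ v) bs) @ t"
    "length bs = length (filter Q vs)" "\<forall>(u, v)\<in>set bs. set u \<subseteq> A \<and> Q v"
    by auto
  \<comment> \<open>A block failing \<open>Q\<close> is glued to the front of the run before the
    next good block, or to the tail if no good block follows.\<close>
  consider "Q v" | "\<not> Q v" "bs = []" | u v' bs' where "\<not> Q v" "bs = (u, v') # bs'"
    by (cases bs) auto
  then show ?case
  proof cases
    case 1
    with bs show ?thesis
      by (intro exI[of _ "([], v) # bs"] exI[of _ t]) auto
  next
    case 2
    with bs show ?thesis
      by (intro exI[of _ "[]"] exI[of _ "v @ t"]) auto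
  next
    case 3
    with bs Cons.prems[of v] show ?thesis
      by (intro exI[of _ "(v @ u, v') # bs'"] exI[of _ t]) auto
  qed
qed

text \<open>Weighting admissible blocks by 2 and the others by 1 gives a sequence of blocks the
  weight 2 to the number of its admissible blocks, at most the separation number of its
  concatenation. Summing these weights gives the power on the left.\<close>

lemma sum_sep_number_ge:
  fixes act :: "'g::monoid_mult \<Rightarrow> 'x::metric_space \<Rightarrow> 'x"
  assumes "compact (UNIV :: 'x set)" "continuous_action act"
    and "weak_orbital_specification G1 act P Gt" "1 \<in> G1" "finite G1"
    and "\<epsilon> > 0" "3 * \<epsilon> \<le> dist (a :: 'x) b" "p \<ge> P \<epsilon>"
  defines "A \<equiv> G1 - {1}"
  shows "(card A ^ p + card {v \<in> words A p. cprod v \<in> Gt \<epsilon> p}) ^ k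
    \<le> (\<Sum>w\<in>words A (k * p). sep_number act w \<epsilon>)"
proof -
  define Q where "Q v \<longleftrightarrow> cprod v \<in> Gt \<epsilon> p" for v
  define f :: "'g list \<Rightarrow> nat" where "f v = (if Q v then 2 else 1)" for v
  have fin: "finite A"
    using assms(5) by (simp add: A_def)
  have "(\<Sum>v\<in>words A p. f v) = (\<Sum>v\<in>words A p. 1) + (\<Sum>v\<in>words A p. if Q v then 1 else 0)"
    unfolding sum.distrib[symmetric] by (intro sum.cong) (auto simp: f_def)
  also have "\<dots> = card A ^ p + card {v \<in> words A p. Q v}"
    using fin by (simp add: card_words sum.If_cases Int_def)
  finally have "(card A ^ p + card {v \<in> words A p. Q v}) ^ k
      = (\<Sum>vs\<in>words (words A p) k. prod_list (map f vs))"
    by (simp add: sum_words_prod_list)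
  also have "\<dots> \<le> (\<Sum>vs\<in>words (words A p) k. sep_number act (concat vs) \<epsilon>)"
  proof (rule sum_mono)
    fix vs assume vs: "vs \<in> words (words A p) k"
    then have "set v \<subseteq> G1" if "v \<in> set vs" for v
      using that by (auto simp: words_def A_def)
    then obtain bs t where bs: "concat vs = concat (map (\<lambda>(u, v). u @ v) bs) @ t"
      "length bs = length (filter Q vs)" "\<forall>(u, v)\<in>set bs. set u \<subseteq> G1 \<and> Q v"
      using split_at_good_blocks[of vs G1 Q] by blast
    have "prod_list (map f vs) = 2 ^ length (filter Q vs)"
      by (induction vs) (auto simp: f_def)
    also have "\<dots> \<le> sep_number act (concat vs) \<epsilon>"
      unfolding bs(1) bs(2)[symmetric] using bs(3)
      by (intro blocks_sep_number[OF assms(1-4,6-8)]) (auto simp: Q_def)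
    finally show "prod_list (map f vs) \<le> sep_number act (concat vs) \<epsilon>" .
  qed
  also have "\<dots> = (\<Sum>w\<in>concat ` words (words A p) k. sep_number act w \<epsilon>)"
    by (simp add: sum.reindex inj_on_concat_words)
  also have "\<dots> \<le> (\<Sum>w\<in>words A (k * p). sep_number act w \<epsilon>)"
    using fin by (intro sum_mono2 concat_words) auto
  finally show ?thesis
    by (simp add: Q_def)
qed

section \<open>The limit over scales\<close>

lemma antimono_on_tendsto_at_right:
  fixes F :: "real \<Rightarrow> ereal"
  assumes "\<And>x y. a < x \<Longrightarrow> x \<le> y \<Longrightarrow> F y \<le> F x"
  shows "(F \<longlongrightarrow> (SUP x\<in>{a<..}. F x)) (at_right a)"
proof (rule order_tendstoI)
  fix l assume "l < (SUP x\<in>{a<..}. F x)"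
  then obtain x where x: "a < x" "l < F x"
    by (auto simp: less_SUP_iff)
  have "eventually (\<lambda>y. y \<in> {a<..<x}) (at_right a)"
    using x(1) by (rule eventually_at_right_real)
  then show "eventually (\<lambda>y. l < F y) (at_right a)"
    by eventually_elim (use x assms in \<open>auto intro: less_le_trans\<close>)
next
  fix u assume u: "(SUP x\<in>{a<..}. F x) < u"
  have "eventually (\<lambda>y. y \<in> {a<..}) (at_right a)"
    by (simp add: eventually_at_right_less)
  then show "eventually (\<lambda>y. F y < u) (at_right a)"
    by eventually_elim (use u in \<open>auto intro: le_less_trans[OF SUP_upper]\<close>)
qed

text \<open>The real-valued term under the \<open>limsup\<close> in
  \<open>top_entropy\<close>.\<close>

definition entropy_at ::
  "'g::monoid_mult set \<Rightarrow> ('g \<Rightarrow> 'x::metric_space \<Rightarrow> 'x) \<Rightarrow> real \<Rightarrow> nat \<Rightarrow> real" where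
  "entropy_at G1 act \<epsilon> n = 1 / real n * ln (1 / real (card (G1 - {1})) ^ n *
     (\<Sum>w\<in>words (G1 - {1}) n. real (sep_number act w \<epsilon>)))"

lemma entropy_at_antimono:
  fixes act :: "'g::monoid_mult \<Rightarrow> 'x::metric_space \<Rightarrow> 'x"
  assumes "compact (UNIV :: 'x set)" "continuous_action act" "finite G1" "card (G1 - {1}) > 0"
    and "0 < \<epsilon>" "\<epsilon> \<le> \<epsilon>'"
  shows "entropy_at G1 act \<epsilon>' n \<le> entropy_at G1 act \<epsilon> n"
proof -
  have "finite (words (G1 - {1}) n)" "words (G1 - {1}) n \<noteq> {}"
    using assms(3,4) card_words[of "G1 - {1}" n]
    by (simp_all, metis card.empty neq0_conv power_not_zero)
  \<comment> \<open>Monotonicity of \<open>ln\<close> is used on positive arguments only.\<close>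
  then have "(\<Sum>w\<in>words (G1 - {1}) n. real (sep_number act w \<epsilon>')) > 0"
    using sep_number_pos[OF assms(1,2), of \<epsilon>'] assms(5,6) by (intro sum_pos) auto
  moreover have "(\<Sum>w\<in>words (G1 - {1}) n. real (sep_number act w \<epsilon>'))
      \<le> (\<Sum>w\<in>words (G1 - {1}) n. real (sep_number act w \<epsilon>))"
    using sep_number_antimono[OF assms(1,2,5,6)] by (intro sum_mono) simp
  ultimately show ?thesis
    unfolding entropy_at_def using assms(4)
    by (intro mult_left_mono ln_mono mult_pos_pos) auto
qed

text \<open>Smaller scales give larger values, so the limit exists and is the supremum over all
  positive scales; a lower bound at one scale therefore suffices.\<close>

lemma limsup_entropy_at_le_top_entropy:
  fixes act :: "'g::monoid_mult \<Rightarrow> 'x::metric_space \<Rightarrow> 'x"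
  assumes "compact (UNIV :: 'x set)" "continuous_action act" "finite G1" "card (G1 - {1}) > 0"
    and "0 < \<epsilon>"
  shows "limsup (\<lambda>n. ereal (entropy_at G1 act \<epsilon> n)) \<le> top_entropy G1 act"
proof -
  define F where "F \<epsilon> = limsup (\<lambda>n. ereal (entropy_at G1 act \<epsilon> n))" for \<epsilon>
  have "F y \<le> F x" if "0 < x" "x \<le> y" for x y
    unfolding F_def using entropy_at_antimono[OF assms(1-4) that]
    by (intro Limsup_mono always_eventually) simp
  then have "(F \<longlongrightarrow> (SUP x\<in>{0<..}. F x)) (at_right 0)"
    by (rule antimono_on_tendsto_at_right)
  moreover have "top_entropy G1 act = Lim (at_right 0) F"
    by (simp add: top_entropy_def F_def[abs_def] entropy_at_def)
  ultimately have "top_entropy G1 act = (SUP x\<in>{0<..}. F x)"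
    by (simp add: tendsto_Lim)
  then show ?thesis
    using assms(5) by (auto simp flip: F_def intro: SUP_upper)
qed

theorem theorem3p5:
  fixes G1 :: "'g::monoid_mult set"
    and act :: "'g \<Rightarrow> 'x::metric_space \<Rightarrow> 'x"
    and P :: "real \<Rightarrow> nat"
    and Gt :: "real \<Rightarrow> nat \<Rightarrow> 'g set"
  assumes "gen_set G1"
    and "compact (UNIV :: 'x set)"
    and "\<exists>a b :: 'x. a \<noteq> b"
    and "continuous_action act"
    and "weak_orbital_specification G1 act P Gt"
    and "\<And>\<epsilon> \<gamma> :: real. 0 < \<epsilon> \<Longrightarrow> 0 < \<gamma> \<Longrightarrow> \<gamma> < 1 \<Longrightarrow>
           limsup (\<lambda>p. ereal (real (card (G_star G1 p - Gt \<epsilon> p)) /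
                              real (card (G1 - {1})) powr (\<gamma> * real p))) < 1"
  shows "top_entropy G1 act > 0"
proof -
  define A where "A = G1 - {1}"
  have G1: "finite G1" "1 \<in> G1"
    using assms(1) by (auto simp: gen_set_def)
  obtain a b :: 'x where ab: "a \<noteq> b"
    using assms(3) by blast
  define \<epsilon> where "\<epsilon> = dist a b / 3"
  have \<epsilon>: "\<epsilon> > 0" "3 * \<epsilon> \<le> dist a b"
    using ab by (auto simp: \<epsilon>_def)
  have P: "P \<epsilon> > 0" "\<And>p. p \<ge> P \<epsilon> \<Longrightarrow> Gt \<epsilon> p \<subseteq> G_star G1 p"
    "(\<lambda>p. real (card (Gt \<epsilon> p)) / real (card (G_star G1 p))) \<longlonglongrightarrow> 1"
    using assms(5) \<epsilon>(1) unfolding weak_orbital_specification_def by blast+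
  \<comment> \<open>The ratio tends to 1, so it is eventually positive, which forces an admissible
    element to exist.\<close>
  have "eventually (\<lambda>p. real (card (Gt \<epsilon> p)) / real (card (G_star G1 p)) > 0 \<and> p \<ge> P \<epsilon>) sequentially"
    using order_tendstoD(1)[OF P(3), of 0] eventually_ge_at_top by (auto intro: eventually_conj)
  then obtain p where p: "card (Gt \<epsilon> p) \<noteq> 0" "p \<ge> P \<epsilon>"
    by (force simp: eventually_sequentially)
  define N where "N = card {v \<in> words A p. cprod v \<in> Gt \<epsilon> p}"
  obtain g where "g \<in> Gt \<epsilon> p"
    using p(1) by fastforce
  then obtain v where v: "v \<in> words A p" "cprod v \<in> Gt \<epsilon> p"
    using P(2)[OF p(2)] by (auto simp: G_star_def A_def)
  have "finite (words A p)"
    using G1 by (simp add: A_def)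
  then have N: "N > 0"
    unfolding N_def using v by (subst card_gt_0_iff) auto
  have p0: "p > 0"
    using P(1) p(2) by simp
  \<comment> \<open>Over an empty alphabet there would be no word of positive length
    \<open>p\<close>.\<close>
  have "card A > 0"
    using card_words[of A p] \<open>finite (words A p)\<close> v(1) p0 by (metis card_0_eq emptyE gr0I power_eq_0_iff)
  \<comment> \<open>The proportion of words of length \<open>p\<close> whose product is
    admissible.\<close>
  define \<theta> where "\<theta> = real N / real (card A) ^ p"
  have \<theta>: "\<theta> > 0"
    using N \<open>card A > 0\<close> by (simp add: \<theta>_def)
  have lower: "entropy_at G1 act \<epsilon> (k * p) \<ge> ln (1 + \<theta>) / p" if "k > 0" for k
  proof -
    have "(1 + \<theta>) ^ k = 1 / real (card A) ^ (k * p) * real ((card A ^ p + N) ^ k)"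
    proof -
      have "1 + \<theta> = real (card A ^ p + N) / real (card A) ^ p"
        using \<open>card A > 0\<close> by (simp add: \<theta>_def field_simps)
      then show ?thesis
        by (simp add: power_divide power_mult mult.commute[of k p])
    qed
    also have "\<dots> \<le> 1 / real (card A) ^ (k * p) * (\<Sum>w\<in>words A (k * p). real (sep_number act w \<epsilon>))"
      using sum_sep_number_ge[OF assms(2,4,5) G1(2,1) \<epsilon> p(2), of k]
      unfolding A_def[symmetric] N_def[symmetric] of_nat_sum[symmetric]
      by (intro mult_left_mono of_nat_mono) auto
    finally have "ln ((1 + \<theta>) ^ k)
        \<le> ln (1 / real (card A) ^ (k * p) * (\<Sum>w\<in>words A (k * p). real (sep_number act w \<epsilon>)))"
      using \<theta> by (intro ln_mono) auto
    then have "1 / real (k * p) * ln ((1 + \<theta>) ^ k) \<le> entropy_at G1 act \<epsilon> (k * p)"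
      unfolding entropy_at_def A_def by (intro mult_left_mono) auto
    then show ?thesis
      using that \<theta> by (simp add: ln_realpow)
  qed
  have "ereal 0 < ereal (ln (1 + \<theta>) / p)"
    using \<theta> p0 by simp
  also have "\<dots> \<le> limsup (\<lambda>n. ereal (entropy_at G1 act \<epsilon> n))"
    unfolding limsup_INF_SUP
  proof (rule INF_greatest)
    fix n
    \<comment> \<open>Every tail of the sequence contains a positive multiple of \<open>p\<close>,
      where the lower bound applies.\<close>
    have "n \<le> Suc n * p"
      using p0 by (cases p) auto
    then show "ereal (ln (1 + \<theta>) / p) \<le> (SUP k\<in>{n..}. ereal (entropy_at G1 act \<epsilon> k))"
      using lower[of "Suc n"] by (intro SUP_upper2[of "Suc n * p"]) auto
  qed
  also have "\<dots> \<le> top_entropy G1 act"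
    using \<open>card A > 0\<close> \<epsilon>(1) G1(1)
    by (intro limsup_entropy_at_le_top_entropy[OF assms(2,4)]) (auto simp: A_def)
  finally show ?thesis
    by (simp add: zero_ereal_def)
qed

end
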